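(* Suppose that the copula function $C(u,v)$ has bounded first-order and bounded second-order partial derivatives on $(0,1)^2$ and that the transformation $\phi$ admits a bounded derivative $\phi'$. Let $a_n=c\log n/n$ for some $c>0$, and let $0<b_n<1$ be such that $\sqrt{n}\,b_n^2/\sqrt{\log\log n}=o(1)$, with $a_n\le b_n$ for all large $n$. Then we have almost surely, as $n\to\infty$, $$\sup_{a_n\le h\le b_n}\ \sup_{(u,v)\in(0,1)^2}\left|\hat{C}_{n,h}^{(T)}(u,v)-C(u,v)\right|\to 0.$$
   Context: Let $(X_1,Y_1),(X_2,Y_2),\dots$ be i.i.d. copies of a random vector $(X,Y)$ with joint cumulative distribution function $H$, continuous marginal distribution functions $F$ and $G$, and copula $C$, i.e. $H(x,y)=C(F(x),G(y))$. Let $F_n$, $G_n$ be the empirical distribution functions of $X_1,\dots,X_n$ and of $Y_1,\dots,Y_n$. The pseudo-observations are $\hat U_i=\frac{n}{n+1}F_n(X_i)$ and $\hat V_i=\frac{n}{n+1}G_n(Y_i)$, $1\le i\le n$. The kernel: $K$ is a univariate kernel distribution function, $K(x)=\int_{-\infty}^x k(s)\,ds$, where $k$ is a symmetric bounded kernel supported on $[-1,1]$ with $\int_{-1}^1 k(s)\,ds=1$, $\int_{-1}^1 s\,k(s)\,ds=0$ and $\int_{-1}^1 s^2k(s)\,ds\neq 0$. The transformation: $\phi$ is an increasing function on $\mathbb{R}$ with values in $[0,1]$ whose inverse $\phi^{-1}$ is defined on $(0,1)$ (for instance the standard Gaussian distribution function). For $0<h<1$ and $(u,v)\in(0,1)^2$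 the transformation kernel estimator of the copula is $$\hat{C}_{n,h}^{(T)}(u,v)=\frac1n\sum_{i=1}^n K\left(\frac{\phi^{-1}(u)-\phi^{-1}(\hat U_i)}{h}\right)K\left(\frac{\phi^{-1}(v)-\phi^{-1}(\hat V_i)}{h}\right).$$ Asymptotic statements concern $n$ large enough that all expressions are defined. *)

theory Defs
  imports "HOL-Probability.Probability" "HOL-Library.Landau_Symbols"
begin

(* Only the values of C on the closed unit square matter. *)
definition is_copula :: "(real \<Rightarrow> real \<Rightarrow> real) \<Rightarrow> bool" where
  "is_copula C \<longleftrightarrow>
     (\<forall>t\<in>{0..1}. C t 0 = 0 \<and> C 0 t = 0 \<and> C t 1 = t \<and> C 1 t = t) \<and>
     (\<forall>u1\<in>{0..1}. \<forall>u2\<in>{0..1}. \<forall>v1\<in>{0..1}. \<forall>v2\<in>{0..1}. u1 \<le> u2 \<longrightarrow> v1 \<le> v2 \<longrightarrow>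
        0 \<le> C u2 v2 - C u2 v1 - C u1 v2 + C u1 v1)"

definition joint_cdf :: "'a measure \<Rightarrow> ('a \<Rightarrow> real) \<Rightarrow> ('a \<Rightarrow> real) \<Rightarrow> real \<Rightarrow> real \<Rightarrow> real" where
  "joint_cdf M X Y x y = measure M {\<omega> \<in> space M. X \<omega> \<le> x \<and> Y \<omega> \<le> y}"

definition has_bounded_partials ::
  "(real \<Rightarrow> real \<Rightarrow> real) \<Rightarrow> (real \<Rightarrow> real \<Rightarrow> real) \<Rightarrow> (real \<Rightarrow> real \<Rightarrow> real) \<Rightarrow> bool" where
  "has_bounded_partials f f1 f2 \<longleftrightarrow>
     (\<forall>u\<in>{0<..<1}. \<forall>v\<in>{0<..<1}.
        ((\<lambda>x. f x v) has_real_derivative f1 u v) (at u) \<and>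
        ((\<lambda>y. f u y) has_real_derivative f2 u v) (at v)) \<and>
     (\<exists>B. \<forall>u\<in>{0<..<1}. \<forall>v\<in>{0<..<1}. \<bar>f1 u v\<bar> \<le> B \<and> \<bar>f2 u v\<bar> \<le> B)"

(* All four second-order derivatives, including both mixed ones, exist; no continuity is required. *)
definition bounded_partials_upto2 :: "(real \<Rightarrow> real \<Rightarrow> real) \<Rightarrow> bool" where
  "bounded_partials_upto2 C \<longleftrightarrow>
     (\<exists>C1 C2 C11 C12 C21 C22.
        has_bounded_partials C C1 C2 \<and>
        has_bounded_partials C1 C11 C12 \<and>
        has_bounded_partials C2 C21 C22)"

(* The kernel is not required to be nonnegative. *)
definition is_kernel :: "(real \<Rightarrow> real) \<Rightarrow> bool" where
  "is_kernel k \<longleftrightarrow>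
     k \<in> borel_measurable borel \<and>
     bounded (range k) \<and>
     (\<forall>s. k (- s) = k s) \<and>
     (\<forall>s. s \<notin> {-1..1} \<longrightarrow> k s = 0) \<and>
     (LINT s:{-1..1}|lborel. k s) = 1 \<and>
     (LINT s:{-1..1}|lborel. s * k s) = 0 \<and>
     (LINT s:{-1..1}|lborel. s\<^sup>2 * k s) \<noteq> 0"

definition kernel_cdf :: "(real \<Rightarrow> real) \<Rightarrow> real \<Rightarrow> real" where
  "kernel_cdf k x = (LINT s:{..x}|lborel. k s)"

(* A sample of size n is x 1, ..., x n; the value x 0 is never used. *)
definition empirical_cdf :: "nat \<Rightarrow> (nat \<Rightarrow> real) \<Rightarrow> real \<Rightarrow> real" where
  "empirical_cdf n x t = real (card {i \<in> {1..n}. x i \<le> t}) / real n"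

definition pseudo_obs :: "nat \<Rightarrow> (nat \<Rightarrow> real) \<Rightarrow> nat \<Rightarrow> real" where
  "pseudo_obs n x i = real n / (real n + 1) * empirical_cdf n x (x i)"

(* Monotone, with a unique preimage for each point of (0,1), so that inv \<phi> is the inverse
   there. Plateaus at the values 0 and 1 are allowed; strictly increasing \<phi> are covered. *)
definition is_transformation :: "(real \<Rightarrow> real) \<Rightarrow> bool" where
  "is_transformation \<phi> \<longleftrightarrow>
     mono \<phi> \<and> range \<phi> \<subseteq> {0..1} \<and> (\<forall>u\<in>{0<..<1}. \<exists>!x. \<phi> x = u)"

(* The pseudo-observations with index 1, ..., n lie in [1/(n+1), n/(n+1)], so inv \<phi> is only
   evaluated inside (0,1) when u and v are. *)
definition transf_copula_est ::
  "(real \<Rightarrow> real) \<Rightarrow> (real \<Rightarrow> real) \<Rightarrow> nat \<Rightarrow> real \<Rightarrow> (nat \<Rightarrow> real) \<Rightarrow> (nat \<Rightarrow> real)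
     \<Rightarrow> real \<Rightarrow> real \<Rightarrow> real" where
  "transf_copula_est k \<phi> n h x y u v =
     1 / real n * (\<Sum>i=1..n.
       kernel_cdf k ((inv \<phi> u - inv \<phi> (pseudo_obs n x i)) / h) *
       kernel_cdf k ((inv \<phi> v - inv \<phi> (pseudo_obs n y i)) / h))"

end

theory Submission
  imports Defs
begin

text \<open>
  Since \<open>\<phi>\<close> is Lipschitz, each kernel factor equals the indicator of \<open>U \<le> u\<close> (with
  \<open>U = F (X i)\<close>) except when \<open>U\<close> lies within \<open>O(h)\<close> of \<open>u\<close>, up to the distance between \<open>U\<close>
  and its pseudo-observation. If the empirical distribution of the pairs
  \<open>(F (X i), G (Y i))\<close> is uniformly within \<open>d\<close> of \<open>C\<close>, then the pseudo-observations are
  within \<open>d + 2/n\<close> of \<open>U\<close>, the fraction of exceptional indices is \<open>O(h + d + 1/n)\<close>, and so is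
  the error of the estimator. That \<open>d\<close> can be taken to tend to 0 almost surely follows from
  Hoeffding's inequality, the Borel--Cantelli lemma and monotonicity on a rational grid.
\<close>

section \<open>Copulas and uniform convergence from a finite grid\<close>

text \<open>Every one-variable step is the nonnegativity of \<open>C\<close> on a rectangle with one
  side on the boundary of the unit square: a side at 0 gives monotonicity, a side at 1 gives the
  Lipschitz constant 1.\<close>

lemma copula_mono_lipschitz:
  assumes "is_copula C" "u \<in> {0..1}" "u' \<in> {0..1}" "v \<in> {0..1}" "v' \<in> {0..1}"
    and "u \<le> u'" "v \<le> v'"
  shows "C u v \<le> C u' v'" and "C u' v' \<le> C u v + (u' - u) + (v' - v)"
proof -
  have bd: "C t 0 = 0" "C 0 t = 0" "C t 1 = t" "C 1 t = t" if "t \<in> {0..1}" for t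
    using assms(1) that by (auto simp: is_copula_def)
  have rect: "0 \<le> C u2 v2 - C u2 v1 - C u1 v2 + C u1 v1"
    if "u1 \<in> {0..1}" "u2 \<in> {0..1}" "v1 \<in> {0..1}" "v2 \<in> {0..1}" "u1 \<le> u2" "v1 \<le> v2" for u1 u2 v1 v2
    using assms(1) that by (auto simp: is_copula_def)
  have 1: "C u v \<le> C u' v" using rect[of u u' 0 v] bd assms(2-) by auto
  have 2: "C u' v \<le> C u' v'" using rect[of 0 u' v v'] bd assms(2-) by auto
  have 3: "C u' v \<le> C u v + (u' - u)" using rect[of u u' v 1] bd assms(2-) by auto
  have 4: "C u' v' \<le> C u' v + (v' - v)" using rect[of u' 1 v v'] bd assms(2-) by auto
  show "C u v \<le> C u' v'" "C u' v' \<le> C u v + (u' - u) + (v' - v)" using 1 2 3 4 by auto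
qed

text \<open>A Polya-type argument: \<open>Q n\<close> is monotone and \<open>C\<close> is Lipschitz,
  so closeness at the corners of a fine grid spreads to the cells. Convergence is asked for at
  rational points only, so that in the almost sure application countably many null sets
  suffice.\<close>

lemma uniform_convergence_to_copula:
  fixes Q :: "nat \<Rightarrow> real \<Rightarrow> real \<Rightarrow> real"
  assumes C: "is_copula C"
    and mono: "\<And>n u u' v v'. u \<le> u' \<Longrightarrow> v \<le> v' \<Longrightarrow> Q n u v \<le> Q n u' v'"
    and conv: "\<And>u v. u \<in> \<rat> \<inter> {0..1} \<Longrightarrow> v \<in> \<rat> \<inter> {0..1} \<Longrightarrow> (\<lambda>n. Q n u v) \<longlonglongrightarrow> C u v"
    and e: "0 < e"
  shows "\<forall>\<^sub>F n in sequentially. \<forall>u\<in>{0..1}. \<forall>v\<in>{0..1}. \<bar>Q n u v - C u v\<bar> \<le> e"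
proof -
  \<comment> \<open>With mesh \<open>1 / N\<close>, moving to a corner of the cell costs at most
    \<open>2 / N \<le> e / 2\<close>; the other half of \<open>e\<close> is left for the error at
    the corner.\<close>
  obtain N :: nat where N: "4 / e < real N" using reals_Archimedean2 by blast
  have "0 < 4 / e" using e by simp
  with N have N0: "0 < real N" by linarith
  have N2: "2 / real N \<le> e / 2" using N N0 e by (simp add: field_simps)
  define r where "r j = real j / real N" for j
  have r01: "r j \<in> {0..1}" if "j \<le> N" for j using that N0 by (simp add: r_def)
  have rQ: "r j \<in> \<rat>" for j by (simp add: r_def)
  have grid: "\<exists>j j'. j \<le> N \<and> j' \<le> N \<and> r j \<le> u \<and> u \<le> r j' \<and> r j' - r j \<le> 1 / real N"
    if u: "u \<in> {0..1}" for u
  proof (intro exI conjI)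
    \<comment> \<open>\<open>?k\<close> indexes the first grid point at or above \<open>u\<close>.
      For \<open>u = 0\<close> the truncated subtraction makes both neighbours equal to 0.\<close>
    let ?k = "nat \<lceil>u * real N\<rceil>"
    have k1: "u * real N \<le> real ?k" by linarith
    have k2: "real ?k < u * real N + 1" using u by auto linarith
    have k3: "u * real N \<le> real N" using u N0 by (simp add: mult_left_le_one_le)
    have kN: "?k \<le> N" using k3 by linarith
    then show "?k - 1 \<le> N" by (rule order_trans[OF diff_le_self])
    show "?k \<le> N" by (fact kN)
    have "real (?k - 1) \<le> u * real N" using k2 u by (cases "?k = 0") auto
    then show "r (?k - 1) \<le> u" using N0 by (simp add: r_def field_simps)
    show "u \<le> r ?k" using k1 N0 by (simp add: r_def field_simps)
    have "real ?k - real (?k - 1) \<le> 1" by linarith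
    then have "(real ?k - real (?k - 1)) / real N \<le> 1 / real N" by (intro divide_right_mono) auto
    then show "r ?k - r (?k - 1) \<le> 1 / real N"
      by (simp add: r_def diff_divide_distrib)
  qed
  have "\<forall>\<^sub>F n in sequentially. \<forall>p\<in>{..N} \<times> {..N}. \<bar>Q n (r (fst p)) (r (snd p)) - C (r (fst p)) (r (snd p))\<bar> < e / 2"
  proof (rule eventually_ball_finite)
    show "\<forall>p\<in>{..N} \<times> {..N}. \<forall>\<^sub>F n in sequentially.
        \<bar>Q n (r (fst p)) (r (snd p)) - C (r (fst p)) (r (snd p))\<bar> < e / 2"
    proof
      fix p :: "nat \<times> nat" assume "p \<in> {..N} \<times> {..N}"
      then have "(\<lambda>n. Q n (r (fst p)) (r (snd p))) \<longlonglongrightarrow> C (r (fst p)) (r (snd p))"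
        using r01 rQ by (intro conv) auto
      from tendstoD[OF this, of "e/2"] e
      show "\<forall>\<^sub>F n in sequentially. \<bar>Q n (r (fst p)) (r (snd p)) - C (r (fst p)) (r (snd p))\<bar> < e / 2"
        by (simp add: dist_real_def)
    qed
  qed auto
  then show ?thesis
  proof eventually_elim
    case (elim n)
    have el: "\<bar>Q n (r j) (r l) - C (r j) (r l)\<bar> < e / 2" if "j \<le> N" "l \<le> N" for j l
      using elim that by auto
    show ?case
    proof (intro ballI)
      fix u v :: real assume u: "u \<in> {0..1}" and v: "v \<in> {0..1}"
      obtain j j' where j: "j \<le> N" "j' \<le> N" "r j \<le> u" "u \<le> r j'" "r j' - r j \<le> 1 / real N"
        using grid[OF u] by blast
      obtain l l' where l: "l \<le> N" "l' \<le> N" "r l \<le> v" "v \<le> r l'" "r l' - r l \<le> 1 / real N"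
        using grid[OF v] by blast
      have h: "1 / real N + 1 / real N \<le> e / 2" using N2 by simp
      \<comment> \<open>From above, \<open>Q n u v\<close> is compared with the upper right corner
        of its cell; the lower left corner then serves for the bound from below.\<close>
      have "Q n u v \<le> Q n (r j') (r l')" using j l by (intro mono)
      moreover have "C (r j') (r l') \<le> C u v + (r j' - u) + (r l' - v)"
        using j l u v r01 by (intro copula_mono_lipschitz[OF C]) auto
      ultimately have 1: "Q n u v - C u v \<le> e" using el[of j' l'] j l h by linarith
      have "Q n (r j) (r l) \<le> Q n u v" using j l by (intro mono)
      moreover have "C u v \<le> C (r j) (r l) + (u - r j) + (v - r l)"
        using j l u v r01 by (intro copula_mono_lipschitz[OF C]) auto
      ultimately have 2: "C u v - Q n u v \<le> e" using el[of j l] j l h by linarith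
      show "\<bar>Q n u v - C u v\<bar> \<le> e" using 1 2 by linarith
    qed
  qed
qed

section \<open>The strong law for relative frequencies\<close>

text \<open>Hoeffding's inequality bounds the probability of a deviation by a geometric sequence in
  \<open>n\<close>; this is summable, so by Borel-Cantelli almost surely only finitely many
  deviations of a given size occur.\<close>

lemma (in prob_space) AE_relative_frequency_tendsto:
  fixes Z :: "nat \<Rightarrow> 'a \<Rightarrow> 'b"
  assumes indep: "indep_vars (\<lambda>_. N) Z {1..}"
    and distr: "\<And>i. i \<ge> 1 \<Longrightarrow> distr M N (Z i) = D"
    and A: "A \<in> sets N"
  shows "AE \<omega> in M. (\<lambda>n. real (card {i\<in>{1..n}. Z i \<omega> \<in> A}) / real n) \<longlonglongrightarrow> measure D A"
proof -
  have Z: "Z i \<in> measurable M N" if "i \<ge> 1" for i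
    using indep that by (auto simp: indep_vars_def)
  define S where "S n \<omega> = (\<Sum>i\<in>{1..n}. indicator A (Z i \<omega>) :: real)" for n \<omega>
  have S_card: "S n \<omega> = real (card {i\<in>{1..n}. Z i \<omega> \<in> A})" for n \<omega>
    unfolding S_def indicator_def by (simp add: Int_def flip: sum.inter_filter)
  have ex: "expectation (\<lambda>\<omega>. indicator A (Z i \<omega>) :: real) = measure D A" if i: "i \<ge> 1" for i
  proof -
    have "expectation (\<lambda>\<omega>. indicator A (Z i \<omega>) :: real) = (LINT z|distr M N (Z i). indicator A z)"
      using Z[OF i] A by (intro integral_distr[symmetric]) auto
    also have "\<dots> = measure D A" unfolding distr[OF i] using A distr[OF i] by auto
    finally show ?thesis .
  qed
  have S_meas [measurable]: "S n \<in> borel_measurable M" for n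
    unfolding S_def
  proof (intro borel_measurable_sum)
    fix i assume "i \<in> {1..n}"
    then have [measurable]: "Z i \<in> measurable M N" using Z by auto
    show "(\<lambda>\<omega>. indicator A (Z i \<omega>) :: real) \<in> borel_measurable M" using A by measurable
  qed
  have tail: "AE \<omega> in M. \<forall>\<^sub>F n in sequentially. \<bar>S n \<omega> - real n * measure D A\<bar> < e * real n"
    if e: "e > 0" for e :: real
  proof -
    define B where "B n = {\<omega> \<in> space M. \<bar>S n \<omega> - real n * measure D A\<bar> \<ge> e * real n}" for n
    have B[measurable]: "B n \<in> sets M" for n unfolding B_def by measurable
    \<comment> \<open>Each indicator has range of length 1, so the squared lengths sum to
      \<open>n\<close> and the Hoeffding exponent \<open>-2 (e n)^2 / n\<close> is linear in
      \<open>n\<close>.\<close>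
    have le: "measure M (B n) \<le> 2 * exp (-2 * e\<^sup>2) ^ n" if n: "n \<ge> 1" for n
    proof -
      interpret H: Hoeffding_ineq M "{1..n}" "\<lambda>i \<omega>. indicator A (Z i \<omega>)" "\<lambda>_. 0" "\<lambda>_. 1"
        "\<Sum>i\<in>{1..n}. expectation (\<lambda>\<omega>. indicator A (Z i \<omega>))"
      proof unfold_locales
        show "indep_vars (\<lambda>_. borel) (\<lambda>i \<omega>. indicator A (Z i \<omega>) :: real) {1..n}"
          using A by (intro indep_vars_compose2[OF indep_vars_subset[OF indep]]) auto
      qed (auto simp: indicator_def)
      have "measure M (B n) \<le> 2 * exp (-2 * (e * real n)\<^sup>2 / (\<Sum>i\<in>{1..n}. (1 - 0)\<^sup>2))"
        using H.Hoeffding_ineq_abs_ge[of "e * real n"] e n by (simp add: B_def S_def ex)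
      also have "-2 * (e * real n)\<^sup>2 / (\<Sum>i\<in>{1..n}. (1 - 0)\<^sup>2) = real n * (-2 * e\<^sup>2)"
        using n by (simp add: power2_eq_square)
      finally show ?thesis unfolding exp_of_nat_mult .
    qed
    have "summable (\<lambda>n. measure M (B n))"
    proof (rule summable_comparison_test'[where N = 1])
      show "summable (\<lambda>n. 2 * exp (-2 * e\<^sup>2) ^ n)"
        using e by (intro summable_mult summable_geometric) auto
      show "norm (measure M (B n)) \<le> 2 * exp (-2 * e\<^sup>2) ^ n" if "n \<ge> 1" for n using le[OF that] by simp
    qed
    from borel_cantelli_AE1[OF B _ this]
    have "AE \<omega> in M. \<forall>\<^sub>F n in sequentially. \<omega> \<in> space M - B n" by (simp add: emeasure_eq_measure)
    then show ?thesis by eventually_elim (auto simp: B_def not_le elim: eventually_mono)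
  qed
  \<comment> \<open>Only the countably many tolerances \<open>1 / (m + 1)\<close> are used, so that
    one null set serves for all of them.\<close>
  have "AE \<omega> in M. \<forall>m::nat. \<forall>\<^sub>F n in sequentially.
      \<bar>S n \<omega> - real n * measure D A\<bar> < inverse (real (Suc m)) * real n"
    unfolding AE_all_countable by (intro allI tail) auto
  then show ?thesis
  proof eventually_elim
    case (elim \<omega>)
    show ?case
    proof (rule tendstoI)
      fix e :: real assume "e > 0"
      then obtain m where m: "inverse (real (Suc m)) < e" using reals_Archimedean by blast
      show "\<forall>\<^sub>F n in sequentially. dist (real (card {i\<in>{1..n}. Z i \<omega> \<in> A}) / real n) (measure D A) < e"
        using elim[rule_format, of m] eventually_gt_at_top[of 0]
      proof eventually_elim
        case (elim n)
        have "\<bar>S n \<omega> / real n - measure D A\<bar> = \<bar>S n \<omega> - real n * measure D A\<bar> / real n"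
          using elim by (simp add: field_simps flip: abs_divide[of _ "real n", simplified])
        also have "\<dots> < inverse (real (Suc m))" using elim by (simp add: field_simps)
        finally show ?case using m by (simp add: dist_real_def S_card)
      qed
    qed
  qed
qed

section \<open>Quantiles and the joint law of \<open>F (X)\<close> and \<open>G (Y)\<close>\<close>

text \<open>The distribution function may be flat at height \<open>u\<close>, so \<open>x\<close>
  has to be the right end of its level set, the largest quantile. The limits at both infinities make
  the sublevel set nonempty and bounded above for \<open>u\<close> strictly between 0 and 1.\<close>

lemma continuous_cdf_quantile:
  assumes "real_distribution D" and cont: "continuous_on UNIV (cdf D)" and u: "u \<in> {0<..<1}"
  obtains x where "cdf D x = u" and "\<And>y. cdf D y \<le> u \<longleftrightarrow> y \<le> x"
proof -
  interpret real_distribution D by fact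
  define S where "S = {y. cdf D y \<le> u}"
  have "\<forall>\<^sub>F x in at_bot. cdf D x < u" using cdf_lim_at_bot u by (intro order_tendstoD) auto
  then obtain a where a: "cdf D a < u" by (auto simp: eventually_at_bot_linorder)
  have "\<forall>\<^sub>F x in at_top. u < cdf D x" using cdf_lim_at_top_prob u by (intro order_tendstoD) auto
  then obtain b where b: "u < cdf D b" by (auto simp: eventually_at_top_linorder)
  have Sb: "y < b" if "y \<in> S" for y using that b cdf_nondecreasing[of b y] by (force simp: S_def)
  have "a \<in> S" using a by (simp add: S_def)
  have bdd: "bdd_above S" using Sb by (meson bdd_above.I less_imp_le)
  have "closed S" unfolding S_def by (intro closed_Collect_le cont continuous_on_const)
  then have xS: "Sup S \<in> S" using \<open>a \<in> S\<close> bdd by (intro closed_contains_Sup) auto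
  \<comment> \<open>This \<open>y\<close> has level exactly \<open>u\<close>, hence lies in
    \<open>S\<close>, and being at least \<open>Sup S\<close> it must equal it. So the level
    \<open>u\<close> is attained at the supremum.\<close>
  obtain y where y: "Sup S \<le> y" "y \<le> b" "cdf D y = u"
    using IVT'[of "cdf D" "Sup S" u b] xS b Sb[OF xS] continuous_on_subset[OF cont]
    by (auto simp: S_def)
  have up: "z \<le> Sup S" if "z \<in> S" for z using bdd that by (rule cSup_upper[rotated])
  show ?thesis
  proof
    show "cdf D (Sup S) = u" using up[of y] y by (simp add: S_def)
    then show "cdf D z \<le> u \<longleftrightarrow> z \<le> Sup S" for z
      using up[of z] cdf_nondecreasing[of z "Sup S"] by (auto simp: S_def)
  qed
qed

text \<open>This is the probability integral transform: for interior levels the event is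
  \<open>X \<le> x\<close> with \<open>x\<close> the largest quantile.\<close>

lemma (in prob_space) prob_cdf_le:
  assumes X[measurable]: "X \<in> borel_measurable M"
    and cont: "continuous_on UNIV (cdf (distr M borel X))" and u: "u \<in> {0..1}"
  shows "prob {\<omega> \<in> space M. cdf (distr M borel X) (X \<omega>) \<le> u} = u"
proof -
  let ?F = "cdf (distr M borel X)"
  have rd: "real_distribution (distr M borel X)" by (rule real_distribution_distr) fact
  interpret D: real_distribution "distr M borel X" by fact
  have [measurable]: "?F \<in> borel_measurable borel" using cont by (rule borel_measurable_continuous_onI)
  have inner: "prob {\<omega> \<in> space M. ?F (X \<omega>) \<le> t} = t" if t: "t \<in> {0<..<1}" for t
  proof -
    obtain x where x: "?F x = t" "\<And>y. ?F y \<le> t \<longleftrightarrow> y \<le> x"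
      using continuous_cdf_quantile[OF rd cont t] by blast
    have "prob {\<omega> \<in> space M. ?F (X \<omega>) \<le> t} = ?F x"
      unfolding x(2) unfolding cdf_def2 by (subst measure_distr) (auto intro!: arg_cong[where f = prob])
    then show ?thesis using x by simp
  qed
  consider "u \<in> {0<..<1}" | "u = 0" | "u = 1" using u by force
  then show ?thesis
  proof cases
    case 1 then show ?thesis by (rule inner)
  next
    case 2
    \<comment> \<open>Level 0 may have no quantile. The event is squeezed instead into events of
      probability \<open>t\<close> for arbitrarily small \<open>t\<close>.\<close>
    have "prob {\<omega> \<in> space M. ?F (X \<omega>) \<le> 0} \<le> t" if "0 < t" "t < 1" for t
      using inner[of t] that
        finite_measure_mono[of "{\<omega> \<in> space M. ?F (X \<omega>) \<le> 0}" "{\<omega> \<in> space M. ?F (X \<omega>) \<le> t}"]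
      by (force intro: order_trans)
    then have "prob {\<omega> \<in> space M. ?F (X \<omega>) \<le> 0} \<le> 0"
      by (intro dense_ge_bounded[of 0 1]) auto
    then show ?thesis using 2 by (simp add: measure_le_0_iff)
  next
    case 3 then show ?thesis using D.cdf_bounded_prob by (simp add: prob_space)
  qed
qed

text \<open>At interior levels the two largest quantiles turn the event into
  \<open>X \<le> x\<close> and \<open>Y \<le> y\<close>, where the Sklar identity applies. On the
  boundary one margin decides: a level 0 forces probability 0, a level 1 imposes no
  constraint.\<close>

lemma (in prob_space) prob_cdf_transform_eq_copula:
  assumes X[measurable]: "X \<in> borel_measurable M" and Y[measurable]: "Y \<in> borel_measurable M"
    and F: "F = cdf (distr M borel X)" and G: "G = cdf (distr M borel Y)"
    and contF: "continuous_on UNIV F" and contG: "continuous_on UNIV G"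
    and C: "is_copula C" and H: "\<And>x y. joint_cdf M X Y x y = C (F x) (G y)"
    and u: "u \<in> {0..1}" and v: "v \<in> {0..1}"
  shows "prob {\<omega> \<in> space M. F (X \<omega>) \<le> u \<and> G (Y \<omega>) \<le> v} = C u v"
proof -
  have [measurable]: "F \<in> borel_measurable borel" "G \<in> borel_measurable borel"
    using contF contG by (auto intro: borel_measurable_continuous_onI)
  have rX: "real_distribution (distr M borel X)" and rY: "real_distribution (distr M borel Y)"
    by auto
  interpret DX: real_distribution "distr M borel X" by fact
  interpret DY: real_distribution "distr M borel Y" by fact
  have F1: "F x \<le> 1" and G1: "G x \<le> 1" for x
    using DX.cdf_bounded_prob DY.cdf_bounded_prob by (auto simp: F G)
  have pX: "prob {\<omega> \<in> space M. F (X \<omega>) \<le> t} = t" if "t \<in> {0..1}" for t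
    using prob_cdf_le[OF X] contF that unfolding F by blast
  have pY: "prob {\<omega> \<in> space M. G (Y \<omega>) \<le> t} = t" if "t \<in> {0..1}" for t
    using prob_cdf_le[OF Y] contG that unfolding G by blast
  have bd: "C t 0 = 0" "C 0 t = 0" "C t 1 = t" "C 1 t = t" if "t \<in> {0..1}" for t
    using C that by (auto simp: is_copula_def)
  have leX: "prob {\<omega> \<in> space M. F (X \<omega>) \<le> u \<and> G (Y \<omega>) \<le> v} \<le> u"
    using finite_measure_mono[of "{\<omega> \<in> space M. F (X \<omega>) \<le> u \<and> G (Y \<omega>) \<le> v}"
        "{\<omega> \<in> space M. F (X \<omega>) \<le> u}"] pX[OF u] by force
  have leY: "prob {\<omega> \<in> space M. F (X \<omega>) \<le> u \<and> G (Y \<omega>) \<le> v} \<le> v"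
    using finite_measure_mono[of "{\<omega> \<in> space M. F (X \<omega>) \<le> u \<and> G (Y \<omega>) \<le> v}"
        "{\<omega> \<in> space M. G (Y \<omega>) \<le> v}"] pY[OF v] by force
  consider "u = 0" | "v = 0" | "u = 1" | "v = 1" | "u \<in> {0<..<1}" "v \<in> {0<..<1}"
    using u v by force
  then show ?thesis
  proof cases
    case 1 then show ?thesis using leX bd v by (simp add: measure_le_0_iff)
  next
    case 2 then show ?thesis using leY bd u by (simp add: measure_le_0_iff)
  next
    case 3 then show ?thesis using pY[OF v] bd v F1 by simp
  next
    case 4 then show ?thesis using pX[OF u] bd u G1 by simp
  next
    case 5
    obtain x where x: "F x = u" "\<And>z. F z \<le> u \<longleftrightarrow> z \<le> x"
      using continuous_cdf_quantile[OF rX _ 5(1)] contF unfolding F by blast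
    obtain y where y: "G y = v" "\<And>z. G z \<le> v \<longleftrightarrow> z \<le> y"
      using continuous_cdf_quantile[OF rY _ 5(2)] contG unfolding G by blast
    show ?thesis using H[of x y] unfolding joint_cdf_def x y .
  qed
qed

section \<open>Counting sample points and locating pseudo-observations\<close>

text \<open>Clipping \<open>t\<close> to the unit interval extends the bound to all real
  \<open>t\<close>, because outside it the fraction is exactly 0 or 1. Later thresholds such as
  \<open>u + r\<close> may leave the interval.\<close>

lemma abs_count_minus_clip_le:
  fixes U :: "nat \<Rightarrow> real"
  assumes n: "n \<ge> 1" and U: "\<And>i. U i \<in> {0..1}"
    and d: "\<And>t. t \<in> {0..1} \<Longrightarrow> \<bar>real (card {i\<in>{1..n}. U i \<le> t}) / real n - t\<bar> \<le> d"
  shows "\<bar>real (card {i\<in>{1..n}. U i \<le> t}) / real n - max 0 (min 1 t)\<bar> \<le> d"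
proof -
  have d0: "0 \<le> d" using order_trans[OF abs_ge_zero d[of 0]] by simp
  consider "t < 0" | "t \<in> {0..1}" | "t > 1" by force
  then show ?thesis
  proof cases
    case 1
    then have "\<not> U i \<le> t" for i using U[of i] by auto
    then have "{i\<in>{1..n}. U i \<le> t} = {}" by blast
    then show ?thesis using 1 d0 by (simp del: Collect_empty_eq)
  next
    case 2
    then have "max 0 (min 1 t) = t" by auto
    then show ?thesis using d[OF 2] by simp
  next
    case 3
    then have "U i \<le> t" for i using U[of i] by auto
    then have "{i\<in>{1..n}. U i \<le> t} = {1..n}" by blast
    then show ?thesis using 3 d0 n by simp
  qed
qed

text \<open>The closed window around \<open>u\<close> lies in the half-open interval from
  \<open>u - 2 * r\<close> to \<open>u + r\<close>, which is a difference of two sublevel sets. Its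
  length gives \<open>3 * r\<close>, and each of the two counts contributes an error
  \<open>d\<close>.\<close>

lemma fraction_near_le:
  fixes U :: "nat \<Rightarrow> real"
  assumes n: "n \<ge> 1" and U: "\<And>i. U i \<in> {0..1}"
    and d: "\<And>t. t \<in> {0..1} \<Longrightarrow> \<bar>real (card {i\<in>{1..n}. U i \<le> t}) / real n - t\<bar> \<le> d"
    and r: "r > 0"
  shows "real (card {i\<in>{1..n}. \<bar>U i - u\<bar> \<le> r}) / real n \<le> 3 * r + 2 * d"
proof -
  let ?S = "\<lambda>t. {i\<in>{1..n}. U i \<le> t}"
  have "card {i\<in>{1..n}. \<bar>U i - u\<bar> \<le> r} \<le> card (?S (u + r) - ?S (u - 2 * r))"
    using r by (intro card_mono) auto
  also have "\<dots> = card (?S (u + r)) - card (?S (u - 2 * r))"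
    using r by (intro card_Diff_subset) auto
  finally have "card {i\<in>{1..n}. \<bar>U i - u\<bar> \<le> r} + card (?S (u - 2 * r)) \<le> card (?S (u + r))"
    using r card_mono[of "?S (u + r)" "?S (u - 2 * r)"] by force
  then have "real (card {i\<in>{1..n}. \<bar>U i - u\<bar> \<le> r}) \<le> real (card (?S (u + r))) - real (card (?S (u - 2 * r)))"
    by linarith
  then have "real (card {i\<in>{1..n}. \<bar>U i - u\<bar> \<le> r}) / real n
      \<le> real (card (?S (u + r))) / real n - real (card (?S (u - 2 * r))) / real n"
    by (simp add: divide_right_mono flip: diff_divide_distrib)
  moreover have "\<bar>real (card (?S t)) / real n - max 0 (min 1 t)\<bar> \<le> d" for t
    by (rule abs_count_minus_clip_le) (use assms in auto)
  note this[of "u + r"] this[of "u - 2 * r"]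
  ultimately show ?thesis using r by linarith
qed

text \<open>Each sample point counts itself, so its rank is at least 1, and the denominator
  \<open>n + 1\<close> exceeds the largest rank.\<close>

lemma pseudo_obs_in_unit:
  assumes "i \<in> {1..n}"
  shows "pseudo_obs n x i \<in> {0<..<1}"
proof -
  let ?c = "card {j\<in>{1..n}. x j \<le> x i}"
  have "?c > 0" using assms by (subst card_gt_0_iff) auto
  moreover have "?c \<le> card {1..n}" by (intro card_mono) auto
  then have "?c \<le> n" by simp
  moreover have "pseudo_obs n x i = real ?c / (real n + 1)"
    using assms by (simp add: pseudo_obs_def empirical_cdf_def)
  ultimately show ?thesis by simp
qed

text \<open>Where \<open>F\<close> is flat, \<open>F (x j) \<le> F (x i)\<close> does not imply
  \<open>x j \<le> x i\<close>. Lowering the threshold by \<open>1 / n\<close> makes the inequality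
  strict, from which the order of the sample points follows. The second \<open>1 / n\<close> pays
  for the factor \<open>n / (n + 1)\<close>.\<close>

lemma pseudo_obs_near_cdf:
  assumes F: "mono F" and F01: "\<And>t. F t \<in> {0..1}" and i: "i \<in> {1..n}"
    and d: "\<And>t. t \<in> {0..1} \<Longrightarrow> \<bar>real (card {j\<in>{1..n}. F (x j) \<le> t}) / real n - t\<bar> \<le> d"
  shows "\<bar>pseudo_obs n x i - F (x i)\<bar> \<le> d + 2 / real n"
proof -
  have n: "n \<ge> 1" using i by auto
  let ?E = "empirical_cdf n x (x i)"
  let ?S = "\<lambda>t. {j\<in>{1..n}. F (x j) \<le> t}"
  have clip: "\<bar>real (card (?S t)) / real n - max 0 (min 1 t)\<bar> \<le> d" for t
    by (rule abs_count_minus_clip_le) (use n F01 d in auto)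
  have "?E \<le> real (card (?S (F (x i)))) / real n"
    unfolding empirical_cdf_def using monoD[OF F]
    by (intro divide_right_mono of_nat_mono card_mono) auto
  then have up: "?E \<le> F (x i) + d" using d[of "F (x i)"] F01[of "x i"] by linarith
  have "real (card (?S (F (x i) - 1 / real n))) / real n \<le> ?E"
    unfolding empirical_cdf_def
  proof (intro divide_right_mono of_nat_mono card_mono subsetI)
    fix j assume j: "j \<in> ?S (F (x i) - 1 / real n)"
    have "0 < 1 / real n" using n by simp
    with j have "F (x j) < F (x i)" unfolding mem_Collect_eq by linarith
    then have "x j \<le> x i" using monoD[OF F, of "x i" "x j"] by linarith
    then show "j \<in> {j\<in>{1..n}. x j \<le> x i}" using j by auto
  qed auto
  moreover have "0 < 1 / real n" using n by simp
  ultimately have lo: "F (x i) - 1 / real n - d \<le> ?E"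
    using clip[of "F (x i) - 1 / real n"] F01[of "x i"] by (auto simp del: zero_less_divide_1_iff)
  have "card {j\<in>{1..n}. x j \<le> x i} \<le> card {1..n}" by (intro card_mono) auto
  then have E01: "0 \<le> ?E" "?E \<le> 1" using n by (auto simp: empirical_cdf_def)
  have "?E - pseudo_obs n x i = ?E / (real n + 1)" by (simp add: pseudo_obs_def field_simps)
  moreover have "0 \<le> ?E / (real n + 1)" using E01 by simp
  moreover have "?E / (real n + 1) \<le> 1 / real n" using E01 n by (intro frac_le) auto
  ultimately show ?thesis using up lo by (simp add: abs_le_iff)
qed

section \<open>Kernel factors under the transformation\<close>

text \<open>As \<open>k\<close> may change sign, \<open>kernel_cdf k\<close> need not stay between 0
  and 1; the integral of the absolute value of \<open>k\<close> serves as \<open>B\<close>.\<close>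

lemma kernel_cdf_properties:
  assumes "is_kernel k"
  obtains B where "0 \<le> B" and "\<And>x. \<bar>kernel_cdf k x\<bar> \<le> B"
    and "\<And>x. x < -1 \<Longrightarrow> kernel_cdf k x = 0" and "\<And>x. 1 < x \<Longrightarrow> kernel_cdf k x = 1"
proof -
  have [measurable]: "k \<in> borel_measurable borel"
    and bounded: "bounded (range k)" and supp: "\<And>s. s \<notin> {-1..1} \<Longrightarrow> k s = 0"
    and int1: "(LINT s:{-1..1}|lborel. k s) = 1"
    using assms by (auto simp: is_kernel_def)
  obtain b where b: "\<And>s. \<bar>k s\<bar> \<le> b" using bounded by (auto simp: bounded_iff)
  have b0: "0 \<le> b" using b[of 0] by linarith
  have ki: "integrable lborel k"
  proof (rule Bochner_Integration.integrable_bound)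
    show "integrable lborel (\<lambda>s. b * indicator {-1..1::real} s)" by simp
    show "AE s in lborel. norm (k s) \<le> norm (b * indicator {-1..1} s)"
      using b b0 supp by (auto simp: indicator_def)
  qed auto
  show ?thesis
  proof
    show "0 \<le> (LINT s|lborel. \<bar>k s\<bar>)" by simp
    show "\<bar>kernel_cdf k x\<bar> \<le> (LINT s|lborel. \<bar>k s\<bar>)" for x
    proof -
      have "\<bar>kernel_cdf k x\<bar> \<le> (LINT s|lborel. \<bar>indicator {..x} s *\<^sub>R k s\<bar>)"
        unfolding kernel_cdf_def set_lebesgue_integral_def by (rule integral_abs_bound)
      also have "\<dots> \<le> (LINT s|lborel. \<bar>k s\<bar>)"
      proof (rule integral_mono)
        show "integrable lborel (\<lambda>s. \<bar>indicator {..x} s *\<^sub>R k s\<bar>)"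
          using ki by (intro integrable_abs integrable_mult_indicator) auto
      qed (use ki in \<open>auto simp: indicator_def\<close>)
      finally show ?thesis .
    qed
    show "kernel_cdf k x = 0" if "x < -1" for x
    proof -
      have "(\<lambda>s. indicator {..x} s *\<^sub>R k s) = (\<lambda>s. 0)" using that supp by (auto simp: indicator_def)
      then show ?thesis unfolding kernel_cdf_def set_lebesgue_integral_def by (simp only: integral_zero)
    qed
    show "kernel_cdf k x = 1" if "1 < x" for x
    proof -
      have "(\<lambda>s. indicator {..x} s *\<^sub>R k s) = (\<lambda>s. indicator {-1..1} s *\<^sub>R k s)"
        using that supp by (auto simp: indicator_def)
      then show ?thesis using int1 unfolding kernel_cdf_def set_lebesgue_integral_def by (simp only:)
    qed
  qed
qed

lemma transformation_inv:
  assumes "is_transformation \<phi>" "u \<in> {0<..<1}"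
  shows "\<phi> (inv \<phi> u) = u"
  using assms by (metis is_transformation_def f_inv_into_f rangeI)

lemma lipschitz_of_bounded_derivative:
  fixes \<phi> \<phi>' :: "real \<Rightarrow> real"
  assumes "\<And>x. (\<phi> has_real_derivative \<phi>' x) (at x)" and "bounded (range \<phi>')"
  obtains L where "0 \<le> L" and "\<And>x y. \<bar>\<phi> x - \<phi> y\<bar> \<le> L * \<bar>x - y\<bar>"
proof -
  obtain L where L: "\<And>x. \<bar>\<phi>' x\<bar> \<le> L" using assms(2) by (auto simp: bounded_iff)
  have "\<bar>\<phi> x - \<phi> y\<bar> \<le> L * \<bar>x - y\<bar>" for x y
    using field_differentiable_bound[of UNIV \<phi> \<phi>' L x y] assms(1) L by auto
  moreover have "0 \<le> L" using L[of 0] by linarith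
  ultimately show ?thesis using that by blast
qed

text \<open>If the kernel argument exceeds 1 in absolute value, the factor is 0 or 1 according to
  the order of \<open>u\<close> and \<open>w\<close>, and it can be wrong only if \<open>u\<close>
  separates \<open>t\<close> from \<open>w\<close>, hence is within \<open>\<delta>\<close> of
  \<open>t\<close>. Otherwise the preimages are within \<open>h\<close>, so \<open>u\<close> and
  \<open>w\<close> are within \<open>L * h\<close>. Since it is \<open>\<phi>\<close> and not its
  inverse that is Lipschitz, this holds uniformly up to the boundary.\<close>

lemma kernel_factor_near_indicator:
  assumes tr: "is_transformation \<phi>" and L: "\<And>x y. \<bar>\<phi> x - \<phi> y\<bar> \<le> L * \<bar>x - y\<bar>" and L0: "0 \<le> L"
    and B: "\<And>x. \<bar>kernel_cdf k x\<bar> \<le> B"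
    and K0: "\<And>x. x < -1 \<Longrightarrow> kernel_cdf k x = 0" and K1: "\<And>x. 1 < x \<Longrightarrow> kernel_cdf k x = 1"
    and u: "u \<in> {0<..<1}" and w: "w \<in> {0<..<1}" and h: "0 < h" and t: "\<bar>w - t\<bar> \<le> \<delta>"
  shows "\<bar>kernel_cdf k ((inv \<phi> u - inv \<phi> w) / h) - of_bool (t \<le> u)\<bar>
    \<le> (B + 1) * of_bool (\<bar>t - u\<bar> \<le> L * h + \<delta>)"
proof -
  have inv: "\<phi> (inv \<phi> u) = u" "\<phi> (inv \<phi> w) = w" using transformation_inv[OF tr] u w by auto
  have mono: "mono \<phi>" using tr by (simp add: is_transformation_def)
  have Lh: "0 \<le> L * h" using L0 h by simp
  let ?s = "(inv \<phi> u - inv \<phi> w) / h"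
  have gen: "\<bar>kernel_cdf k ?s - of_bool (t \<le> u)\<bar> \<le> B + 1" using B[of ?s] by (cases "t \<le> u") auto
  have B0: "0 \<le> B" using B[of 0] by linarith
  consider "?s < -1" | "1 < ?s" | "\<bar>?s\<bar> \<le> 1" by linarith
  then show ?thesis
  proof cases
    case 1
    then have "inv \<phi> u \<le> inv \<phi> w" using h by (simp add: field_simps)
    then have "u \<le> w" using monoD[OF mono, of "inv \<phi> u" "inv \<phi> w"] inv by simp
    then have "t \<le> u \<Longrightarrow> \<bar>t - u\<bar> \<le> L * h + \<delta>" using t Lh by linarith
    then show ?thesis using K0[OF 1] B0 gen by (auto split: split_of_bool)
  next
    case 2
    then have "inv \<phi> w \<le> inv \<phi> u" using h by (simp add: field_simps)
    then have "w \<le> u" using monoD[OF mono, of "inv \<phi> w" "inv \<phi> u"] inv by simp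
    then have "\<not> t \<le> u \<Longrightarrow> \<bar>t - u\<bar> \<le> L * h + \<delta>" using t Lh by linarith
    then show ?thesis using K1[OF 2] B0 gen by (auto split: split_of_bool)
  next
    case 3
    then have "\<bar>inv \<phi> u - inv \<phi> w\<bar> \<le> h" using h by (simp add: field_simps)
    then have "L * \<bar>inv \<phi> u - inv \<phi> w\<bar> \<le> L * h" using L0 by (rule mult_left_mono)
    then have "\<bar>u - w\<bar> \<le> L * h" using L[of "inv \<phi> u" "inv \<phi> w"] inv by simp
    then have "\<bar>t - u\<bar> \<le> L * h + \<delta>" using t by linarith
    then show ?thesis using gen by simp
  qed
qed

section \<open>Deterministic error bound for the estimator\<close>

text \<open>Here \<open>d\<close> bounds the error of the empirical distribution of the transformed
  pairs. The second summand counts, for each of the two coordinates, the indices within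
  \<open>L * h + d + 2 / n\<close> of the evaluation point; an exceptional index costs at most
  \<open>(B + 1)^2\<close> per coordinate.\<close>

lemma transf_copula_est_error:
  assumes F: "mono F" "\<And>t. F t \<in> {0..1}" and G: "mono G" "\<And>t. G t \<in> {0..1}"
    and tr: "is_transformation \<phi>" and L: "\<And>x y. \<bar>\<phi> x - \<phi> y\<bar> \<le> L * \<bar>x - y\<bar>" and L0: "0 \<le> L"
    and B: "\<And>x. \<bar>kernel_cdf k x\<bar> \<le> B"
    and K0: "\<And>x. x < -1 \<Longrightarrow> kernel_cdf k x = 0" and K1: "\<And>x. 1 < x \<Longrightarrow> kernel_cdf k x = 1"
    and u: "u \<in> {0<..<1}" and v: "v \<in> {0<..<1}" and h: "0 < h" and n: "n \<ge> 1" and C: "is_copula C"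
    and d: "\<And>u v. u \<in> {0..1} \<Longrightarrow> v \<in> {0..1} \<Longrightarrow>
        \<bar>real (card {i\<in>{1..n}. F (x i) \<le> u \<and> G (y i) \<le> v}) / real n - C u v\<bar> \<le> d"
  shows "\<bar>transf_copula_est k \<phi> n h x y u v - C u v\<bar>
    \<le> d + (B + 1)\<^sup>2 * (2 * (3 * (L * h + d + 2 / real n) + 2 * d))"
proof -
  define r where "r = L * h + (d + 2 / real n)"
  have d0: "0 \<le> d" using order_trans[OF abs_ge_zero d[of 0 0]] by simp
  have r0: "0 < r" using L0 h n d0 by (simp add: r_def add_nonneg_pos)
  have B0: "0 \<le> B" using B[of 0] by linarith
  \<comment> \<open>Setting the other level to 1 removes its constraint, so the joint bound controls
    both margins.\<close>
  have dF: "\<bar>real (card {i\<in>{1..n}. F (x i) \<le> t}) / real n - t\<bar> \<le> d" if "t \<in> {0..1}" for t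
    using d[of t 1] that G(2) C by (simp add: is_copula_def)
  have dG: "\<bar>real (card {i\<in>{1..n}. G (y i) \<le> t}) / real n - t\<bar> \<le> d" if "t \<in> {0..1}" for t
    using d[of 1 t] that F(2) C by (simp add: is_copula_def)
  define K1 where "K1 i = kernel_cdf k ((inv \<phi> u - inv \<phi> (pseudo_obs n x i)) / h)" for i
  define K2 where "K2 i = kernel_cdf k ((inv \<phi> v - inv \<phi> (pseudo_obs n y i)) / h)" for i
  define I1 where "I1 i = (of_bool (F (x i) \<le> u) :: real)" for i
  define I2 where "I2 i = (of_bool (G (y i) \<le> v) :: real)" for i
  define N1 where "N1 i = (of_bool (\<bar>F (x i) - u\<bar> \<le> r) :: real)" for i
  define N2 where "N2 i = (of_bool (\<bar>G (y i) - v\<bar> \<le> r) :: real)" for i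
  have step: "\<bar>K1 i * K2 i - I1 i * I2 i\<bar> \<le> (B + 1)\<^sup>2 * (N1 i + N2 i)" if i: "i \<in> {1..n}" for i
  proof -
    have a: "\<bar>K1 i - I1 i\<bar> \<le> (B + 1) * N1 i"
      unfolding K1_def I1_def N1_def r_def
      by (rule kernel_factor_near_indicator)
        (use assms i pseudo_obs_in_unit pseudo_obs_near_cdf[OF F i dF] in auto)
    have b: "\<bar>K2 i - I2 i\<bar> \<le> (B + 1) * N2 i"
      unfolding K2_def I2_def N2_def r_def
      by (rule kernel_factor_near_indicator)
        (use assms i pseudo_obs_in_unit pseudo_obs_near_cdf[OF G i dG] in auto)
    have N0: "0 \<le> N1 i" "0 \<le> N2 i" by (auto simp: N1_def N2_def)
    have c: "\<bar>K1 i\<bar> \<le> B + 1" using B unfolding K1_def by (meson add_increasing2 zero_le_one)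
    have e: "\<bar>I2 i\<bar> \<le> B + 1" using B0 by (simp add: I2_def)
    \<comment> \<open>One factor is exchanged at a time; \<open>\<bar>K1 i\<bar>\<close> and
      \<open>\<bar>I2 i\<bar>\<close> are both at most \<open>B + 1\<close>, which gives the common
      coefficient.\<close>
    have "\<bar>K1 i * K2 i - I1 i * I2 i\<bar> = \<bar>K1 i * (K2 i - I2 i) + (K1 i - I1 i) * I2 i\<bar>"
      by (simp add: algebra_simps)
    also have "\<dots> \<le> \<bar>K1 i\<bar> * \<bar>K2 i - I2 i\<bar> + \<bar>K1 i - I1 i\<bar> * \<bar>I2 i\<bar>"
      by (metis abs_mult abs_triangle_ineq)
    also have "\<dots> \<le> (B + 1) * ((B + 1) * N2 i) + ((B + 1) * N1 i) * (B + 1)"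
      using a b c e N0 B0 by (intro add_mono mult_mono) auto
    also have "\<dots> = (B + 1)\<^sup>2 * (N1 i + N2 i)" by (simp add: power2_eq_square algebra_simps)
    finally show ?thesis .
  qed
  have sI: "(\<Sum>i=1..n. I1 i * I2 i) = real (card {i\<in>{1..n}. F (x i) \<le> u \<and> G (y i) \<le> v})"
    by (simp add: I1_def I2_def Int_def flip: of_bool_conj)
  have sN1: "(\<Sum>i=1..n. N1 i) = real (card {i\<in>{1..n}. \<bar>F (x i) - u\<bar> \<le> r})"
    by (simp add: N1_def Int_def)
  have sN2: "(\<Sum>i=1..n. N2 i) = real (card {i\<in>{1..n}. \<bar>G (y i) - v\<bar> \<le> r})"
    by (simp add: N2_def Int_def)
  have "\<bar>(\<Sum>i=1..n. K1 i * K2 i) - (\<Sum>i=1..n. I1 i * I2 i)\<bar> \<le> (\<Sum>i=1..n. (B + 1)\<^sup>2 * (N1 i + N2 i))"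
    unfolding sum_subtractf[symmetric] by (rule order_trans[OF sum_abs sum_mono]) (rule step)
  also have "\<dots> = (B + 1)\<^sup>2 * ((\<Sum>i=1..n. N1 i) + (\<Sum>i=1..n. N2 i))"
    by (simp flip: sum_distrib_left add: sum.distrib)
  finally have main: "\<bar>(\<Sum>i=1..n. K1 i * K2 i) / real n - (\<Sum>i=1..n. I1 i * I2 i) / real n\<bar>
      \<le> (B + 1)\<^sup>2 * ((\<Sum>i=1..n. N1 i) / real n + (\<Sum>i=1..n. N2 i) / real n)"
    using n by (simp add: divide_right_mono flip: diff_divide_distrib add_divide_distrib)
  have "(\<Sum>i=1..n. N1 i) / real n \<le> 3 * r + 2 * d"
    unfolding sN1 by (rule fraction_near_le) (use n F dF r0 in auto)
  moreover have "(\<Sum>i=1..n. N2 i) / real n \<le> 3 * r + 2 * d"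
    unfolding sN2 by (rule fraction_near_le) (use n G dG r0 in auto)
  ultimately have "(B + 1)\<^sup>2 * ((\<Sum>i=1..n. N1 i) / real n + (\<Sum>i=1..n. N2 i) / real n)
      \<le> (B + 1)\<^sup>2 * (2 * (3 * r + 2 * d))"
    by (intro mult_left_mono) auto
  moreover have "\<bar>(\<Sum>i=1..n. I1 i * I2 i) / real n - C u v\<bar> \<le> d"
    unfolding sI using u v by (intro d) auto
  moreover have "transf_copula_est k \<phi> n h x y u v = (\<Sum>i=1..n. K1 i * K2 i) / real n"
    by (simp add: transf_copula_est_def K1_def K2_def)
  moreover have "r = L * h + d + 2 / real n" by (simp add: r_def)
  ultimately show ?thesis using main by (simp only:)
qed

section \<open>Vanishing bandwidth and almost sure uniform convergence\<close>

text \<open>Since \<open>ln (ln n) \<le> n\<close>, the quantity assumed to vanish eventually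
  dominates \<open>(b n)^2\<close>.\<close>

lemma bandwidth_tendsto_0:
  fixes b :: "nat \<Rightarrow> real"
  assumes b: "\<And>n. n \<ge> 1 \<Longrightarrow> 0 < b n"
    and o: "(\<lambda>n. sqrt (real n) * (b n)\<^sup>2 / sqrt (ln (ln (real n)))) \<in> o(\<lambda>_. 1)"
  shows "b \<longlonglongrightarrow> 0"
proof -
  have lim: "(\<lambda>n. sqrt (real n) * (b n)\<^sup>2 / sqrt (ln (ln (real n)))) \<longlonglongrightarrow> 0"
    using smalloD_tendsto[OF o] by simp
  have "(\<lambda>n. (b n)\<^sup>2) \<longlonglongrightarrow> 0"
  proof (rule tendsto_sandwich[OF _ _ tendsto_const lim])
    show "\<forall>\<^sub>F n in sequentially. (b n)\<^sup>2 \<le> sqrt (real n) * (b n)\<^sup>2 / sqrt (ln (ln (real n)))"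
      using eventually_ge_at_top[of 3]
    proof eventually_elim
      case (elim n)
      \<comment> \<open>From \<open>n = 3\<close> on, \<open>n\<close> exceeds Euler's number, so
        the iterated logarithm is positive and dividing by its root keeps the inequality.\<close>
      have "exp 1 < real n" using e_less_272 elim by linarith
      then have l1: "1 < ln (real n)" using elim by (metis exp_less_cancel_iff exp_ln less_trans exp_gt_zero)
      then have l2: "0 < ln (ln (real n))" by simp
      have "ln (ln (real n)) \<le> ln (real n)" using l1 by (intro less_imp_le ln_less_self) auto
      also have "\<dots> \<le> real n" using elim by (intro less_imp_le ln_less_self) auto
      finally have "sqrt (ln (ln (real n))) * (b n)\<^sup>2 \<le> sqrt (real n) * (b n)\<^sup>2"
        by (intro mult_right_mono) auto
      then show ?case using l2 by (simp add: field_simps)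
    qed
  qed auto
  then have "(\<lambda>n. sqrt ((b n)\<^sup>2)) \<longlonglongrightarrow> sqrt 0" by (rule tendsto_real_sqrt)
  then have "(\<lambda>n. \<bar>b n\<bar>) \<longlonglongrightarrow> 0" by simp
  then show ?thesis by (simp add: tendsto_rabs_zero_iff)
qed

text \<open>A bivariate Glivenko-Cantelli statement: the pairs \<open>(F (Xs i), G (Ys i))\<close>
  have joint distribution function \<open>C\<close>, so the strong law applies at each rational
  point of the square, and the grid argument makes the convergence uniform.\<close>

lemma (in prob_space) AE_uniform_convergence_to_copula:
  assumes X[measurable]: "X \<in> borel_measurable M" and Y[measurable]: "Y \<in> borel_measurable M"
    and F: "F = cdf (distr M borel X)" and G: "G = cdf (distr M borel Y)"
    and contF: "continuous_on UNIV F" and contG: "continuous_on UNIV G"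
    and C: "is_copula C" and H: "\<And>x y. joint_cdf M X Y x y = C (F x) (G y)"
    and indep: "indep_vars (\<lambda>_. borel) (\<lambda>i \<omega>. (Xs i \<omega>, Ys i \<omega>)) {1..}"
    and distr: "\<And>i. i \<ge> 1 \<Longrightarrow>
      distr M borel (\<lambda>\<omega>. (Xs i \<omega>, Ys i \<omega>)) = distr M borel (\<lambda>\<omega>. (X \<omega>, Y \<omega>))"
  shows "AE \<omega> in M. \<forall>e>0. \<forall>\<^sub>F n in sequentially. \<forall>u\<in>{0..1}. \<forall>v\<in>{0..1}.
    \<bar>real (card {i\<in>{1..n}. F (Xs i \<omega>) \<le> u \<and> G (Ys i \<omega>) \<le> v}) / real n - C u v\<bar> \<le> e"
proof -
  have [measurable]: "F \<in> borel_measurable borel" "G \<in> borel_measurable borel"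
    using contF contG by (auto intro: borel_measurable_continuous_onI)
  define A where "A u v = {z :: real \<times> real. F (fst z) \<le> u \<and> G (snd z) \<le> v}" for u v
  have A: "A u v \<in> sets borel" for u v
  proof -
    have "{z \<in> space (borel \<Otimes>\<^sub>M borel). F (fst z) \<le> u \<and> G (snd z) \<le> v} \<in> sets (borel \<Otimes>\<^sub>M borel)"
      by measurable
    then show ?thesis unfolding A_def borel_prod by simp
  qed
  have "(\<lambda>\<omega>. (X \<omega>, Y \<omega>)) \<in> borel_measurable M" by measurable
  then have meas: "measure (distr M borel (\<lambda>\<omega>. (X \<omega>, Y \<omega>))) (A u v)
      = prob {\<omega> \<in> space M. F (X \<omega>) \<le> u \<and> G (Y \<omega>) \<le> v}" for u v
    using A by (subst measure_distr) (auto simp: A_def intro!: arg_cong[where f = prob])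
  have pt: "AE \<omega> in M. (\<lambda>n. real (card {i\<in>{1..n}. F (Xs i \<omega>) \<le> u \<and> G (Ys i \<omega>) \<le> v}) / real n) \<longlonglongrightarrow> C u v"
    if "u \<in> {0..1}" "v \<in> {0..1}" for u v
    using AE_relative_frequency_tendsto[OF indep distr A, of u v]
    unfolding meas prob_cdf_transform_eq_copula[OF X Y F G contF contG C H that]
    by (simp add: A_def)
  have "AE \<omega> in M. \<forall>p \<in> (\<rat> \<inter> {0..1}) \<times> (\<rat> \<inter> {0..1}).
      (\<lambda>n. real (card {i\<in>{1..n}. F (Xs i \<omega>) \<le> fst p \<and> G (Ys i \<omega>) \<le> snd p}) / real n) \<longlonglongrightarrow> C (fst p) (snd p)"
  proof (subst AE_ball_countable)
    show "countable ((\<rat> \<inter> {0..1}) \<times> (\<rat> \<inter> {0..1}) :: (real \<times> real) set)"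
      by (intro countable_SIGMA countable_Int1 countable_rat)
  qed (intro ballI pt; auto)
  then show ?thesis
  proof eventually_elim
    case (elim \<omega>)
    show ?case
    proof (intro allI impI)
      fix e :: real assume "0 < e"
      then show "\<forall>\<^sub>F n in sequentially. \<forall>u\<in>{0..1}. \<forall>v\<in>{0..1}.
          \<bar>real (card {i\<in>{1..n}. F (Xs i \<omega>) \<le> u \<and> G (Ys i \<omega>) \<le> v}) / real n - C u v\<bar> \<le> e"
        using elim
        by (intro uniform_convergence_to_copula[OF C])
          (auto intro!: divide_right_mono of_nat_mono card_mono)
    qed
  qed
qed

section \<open>Uniformity in the bandwidth and in the evaluation point\<close>

theorem proposition1:
  fixes M :: "'a measure"
    and X Y :: "'a \<Rightarrow> real"
    and Xs Ys :: "nat \<Rightarrow> 'a \<Rightarrow> real"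
    and F G :: "real \<Rightarrow> real"
    and H C :: "real \<Rightarrow> real \<Rightarrow> real"
    and k \<phi> \<phi>' :: "real \<Rightarrow> real"
    and c :: real
    and a b :: "nat \<Rightarrow> real"
  assumes "prob_space M"
    and "X \<in> borel_measurable M" and "Y \<in> borel_measurable M"
    and "prob_space.indep_vars M (\<lambda>_. borel) (\<lambda>i \<omega>. (Xs i \<omega>, Ys i \<omega>)) {1..}"
    and "\<And>i. i \<ge> 1 \<Longrightarrow>
           distr M borel (\<lambda>\<omega>. (Xs i \<omega>, Ys i \<omega>)) = distr M borel (\<lambda>\<omega>. (X \<omega>, Y \<omega>))"
    and "H = joint_cdf M X Y"
    and "F = cdf (distr M borel X)" and "G = cdf (distr M borel Y)"
    and "continuous_on UNIV F" and "continuous_on UNIV G"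
    and "is_copula C" and "\<And>x y. H x y = C (F x) (G y)"
    and "bounded_partials_upto2 C"
    and "is_kernel k"
    and "is_transformation \<phi>"
    and "\<And>x. (\<phi> has_real_derivative \<phi>' x) (at x)" and "bounded (range \<phi>')"
    and "c > 0" and "\<And>n. a n = c * ln (real n) / real n"
    and "\<And>n. n \<ge> 1 \<Longrightarrow> 0 < b n \<and> b n < 1"
    and "(\<lambda>n. sqrt (real n) * (b n)\<^sup>2 / sqrt (ln (ln (real n)))) \<in> o(\<lambda>_. 1)"
    and "\<forall>\<^sub>F n in sequentially. a n \<le> b n"
  shows "AE \<omega> in M.
    (\<lambda>n. SUP h\<in>{a n..b n}. SUP (u, v)\<in>{0<..<1} \<times> {0<..<1}.
       ereal \<bar>transf_copula_est k \<phi> n h (\<lambda>i. Xs i \<omega>) (\<lambda>i. Ys i \<omega>) u v - C u v\<bar>)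
    \<longlonglongrightarrow> 0"
proof -
  interpret prob_space M by fact
  note X = assms(2) and Y = assms(3) and FG = assms(7,8) and C = assms(11) and tr = assms(15)
  have rd: "real_distribution (distr M borel X)" "real_distribution (distr M borel Y)"
    using X Y by auto
  interpret DX: real_distribution "distr M borel X" by (fact rd(1))
  interpret DY: real_distribution "distr M borel Y" by (fact rd(2))
  have F: "mono F" "\<And>t. F t \<in> {0..1}"
    using DX.cdf_nondecreasing DX.cdf_nonneg DX.cdf_bounded_prob by (auto simp: FG mono_def)
  have G: "mono G" "\<And>t. G t \<in> {0..1}"
    using DY.cdf_nondecreasing DY.cdf_nonneg DY.cdf_bounded_prob by (auto simp: FG mono_def)
  have H: "joint_cdf M X Y x y = C (F x) (G y)" for x y using assms(6,12) by simp
  obtain B where B: "0 \<le> B" "\<And>x. \<bar>kernel_cdf k x\<bar> \<le> B"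
    "\<And>x. x < -1 \<Longrightarrow> kernel_cdf k x = 0" "\<And>x. 1 < x \<Longrightarrow> kernel_cdf k x = 1"
    using kernel_cdf_properties[OF assms(14)] by blast
  obtain L where L: "0 \<le> L" "\<And>x y. \<bar>\<phi> x - \<phi> y\<bar> \<le> L * \<bar>x - y\<bar>"
    using lipschitz_of_bounded_derivative[OF assms(16,17)] by blast
  have b0: "b \<longlonglongrightarrow> 0" using bandwidth_tendsto_0[OF _ assms(21)] assms(20) by blast
  \<comment> \<open>\<open>A\<close> is chosen so that the deterministic error bound becomes
    \<open>d * A\<close> once \<open>h\<close>, \<open>2 / n\<close> and the empirical error are all
    replaced by \<open>d\<close>.\<close>
  define A where "A = 1 + (B + 1)\<^sup>2 * (2 * (3 * (L + 2) + 2))"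
  have A: "0 < A" using L by (simp add: A_def add_pos_nonneg)
  have "AE \<omega> in M. \<forall>e>0. \<forall>\<^sub>F n in sequentially. \<forall>u\<in>{0..1}. \<forall>v\<in>{0..1}.
    \<bar>real (card {i\<in>{1..n}. F (Xs i \<omega>) \<le> u \<and> G (Ys i \<omega>) \<le> v}) / real n - C u v\<bar> \<le> e"
    using assms(4,5,9,10) H by (intro AE_uniform_convergence_to_copula[OF X Y FG _ _ C])
  then show ?thesis
  proof eventually_elim
    case (elim \<omega>)
    let ?est = "\<lambda>n h u v. transf_copula_est k \<phi> n h (\<lambda>i. Xs i \<omega>) (\<lambda>i. Ys i \<omega>) u v"
    let ?sup = "\<lambda>n. SUP h\<in>{a n..b n}. SUP (u, v)\<in>{0<..<1} \<times> {0<..<1}. ereal \<bar>?est n h u v - C u v\<bar>"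
    \<comment> \<open>The lower bound needs an argument because an empty supremum in
      \<open>ereal\<close> is minus infinity.\<close>
    have bound: "\<forall>\<^sub>F n in sequentially. 0 \<le> ?sup n \<and> ?sup n \<le> ereal e" if e: "e > 0" for e
    proof -
      define d where "d = e / A"
      have d: "0 < d" using e A by (simp add: d_def)
      have "\<forall>\<^sub>F n in sequentially. 2 / real n < d"
        using d by (intro order_tendstoD[OF lim_const_over_n])
      moreover have "\<forall>\<^sub>F n in sequentially. b n < d" using b0 d by (intro order_tendstoD)
      ultimately show ?thesis
        using elim[rule_format, OF d] assms(22) eventually_ge_at_top[of 2]
      proof eventually_elim
        case (elim n)
        \<comment> \<open>For \<open>n \<ge> 2\<close> the logarithm is positive, so every
          admissible \<open>h\<close> is positive.\<close>
        have a0: "0 < a n" using elim(5) assms(18,19) by simp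
        have le: "\<bar>?est n h u v - C u v\<bar> \<le> e"
          if h: "h \<in> {a n..b n}" and u: "u \<in> {0<..<1}" and v: "v \<in> {0<..<1}" for h u v
        proof -
          have "\<bar>?est n h u v - C u v\<bar> \<le> d + (B + 1)\<^sup>2 * (2 * (3 * (L * h + d + 2 / real n) + 2 * d))"
          proof (rule transf_copula_est_error[OF F G tr L(2,1) B(2-4) u v _ _ C])
            show "\<bar>real (card {i\<in>{1..n}. F (Xs i \<omega>) \<le> u \<and> G (Ys i \<omega>) \<le> v}) / real n - C u v\<bar> \<le> d"
              if "u \<in> {0..1}" "v \<in> {0..1}" for u v using elim(3) that by blast
          qed (use h a0 elim(5) in auto)
          \<comment> \<open>The bound increases with \<open>h\<close>, and
            \<open>h \<le> b n < d\<close>; this yields uniformity over the bandwidths.\<close>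
          also have "\<dots> \<le> d + (B + 1)\<^sup>2 * (2 * (3 * (L * d + d + d) + 2 * d))"
            using elim(1,2) h L(1)
            by (intro add_left_mono mult_left_mono add_mono add_right_mono) auto
          also have "\<dots> = d * A" by (simp add: A_def algebra_simps)
          also have "\<dots> = e" using A by (simp add: d_def)
          finally show ?thesis .
        qed
        have ne: "a n \<in> {a n..b n}" "(1/2 :: real, 1/2 :: real) \<in> {0<..<1} \<times> {0<..<1}"
          using elim(4) by auto
        have "0 \<le> ?sup n"
          by (rule SUP_upper2[OF ne(1)], rule SUP_upper2[OF ne(2)]) simp
        moreover have "?sup n \<le> ereal e"
          using le by (auto intro!: SUP_least)
        ultimately show ?case by blast
      qed
    qed
    show ?case
    proof (rule order_tendstoI)
      fix l :: ereal assume "l < 0"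
      with bound[of 1] show "\<forall>\<^sub>F n in sequentially. l < ?sup n"
        by (auto elim!: eventually_mono)
    next
      fix l :: ereal assume "0 < l"
      then obtain e where e: "0 < ereal e" "ereal e < l" using ereal_dense2 by blast
      from bound[of e] e show "\<forall>\<^sub>F n in sequentially. ?sup n < l"
        by (auto elim!: eventually_mono)
    qed
  qed
qed

end
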